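(* Let $G$ be a finite simple graph on $n$ vertices and let $\bar{G}$ be its complement. Then $m_G[0,1) + m_{\bar{G}}[0,1) \leq n+1$, with equality if and only if $G = K_n$ or $G = \bar{K_n}$ (the complete graph or the edgeless graph on $n$ vertices).
   Context: For a finite simple undirected graph $G$ on $n$ vertices, its Laplacian matrix is $L_G = D - A$, where $A$ is the adjacency matrix and $D$ is the diagonal matrix of vertex degrees. For a real interval $I$, $m_G(I)$ denotes the number of Laplacian eigenvalues of $G$, counted with multiplicity, lying in $I$. *)

theory Defs
  imports
    "Graph_Theory.Graph_Theory"
    "Jordan_Normal_Form.Char_Poly"
begin

text \<open>
  A finite simple undirected graph is a \<^locale>\<open>pair_graph\<close>: a finite vertex set together with a
  symmetric irreflexive set of ordered pairs, so each edge occurs in both orientations.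
  In particular, the out-degree of a vertex is its number of neighbours.
\<close>

definition graph_complement :: "'a pair_pre_digraph \<Rightarrow> 'a pair_pre_digraph" where
  "graph_complement G = \<lparr> pverts = pverts G,
     parcs = {(u, v). u \<in> pverts G \<and> v \<in> pverts G \<and> u \<noteq> v \<and> (u, v) \<notin> parcs G} \<rparr>"

text \<open>
  Matrices are indexed by natural numbers, so they are formed with respect to a list
  \<open>vs\<close> that enumerates the vertices without repetition.
\<close>

definition adjacency_mat :: "'a list \<Rightarrow> 'a pair_pre_digraph \<Rightarrow> real mat" where
  "adjacency_mat vs G = mat (length vs) (length vs)
     (\<lambda>(i, j). if (vs ! i, vs ! j) \<in> parcs G then 1 else 0)"

definition degree_mat :: "'a list \<Rightarrow> 'a pair_pre_digraph \<Rightarrow> real mat" where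
  "degree_mat vs G = mat (length vs) (length vs)
     (\<lambda>(i, j). if i = j then real (out_degree (with_proj G) (vs ! i)) else 0)"

definition laplacian_mat :: "'a list \<Rightarrow> 'a pair_pre_digraph \<Rightarrow> real mat" where
  "laplacian_mat vs G = degree_mat vs G - adjacency_mat vs G"

definition vertex_enum :: "'a pair_pre_digraph \<Rightarrow> 'a list" where
  "vertex_enum G = (SOME vs. distinct vs \<and> set vs = pverts G)"

text \<open>
  The multiplicity of an eigenvalue is its algebraic multiplicity. The choice of the enumeration is
  immaterial, see \<open>laplacian_count_enum\<close> below.
\<close>

definition laplacian_count :: "'a pair_pre_digraph \<Rightarrow> real set \<Rightarrow> nat" where
  "laplacian_count G I =
     (let L = laplacian_mat (vertex_enum G) G
      in \<Sum>\<theta> | \<theta> \<in> I \<and> eigenvalue L \<theta>. Polynomial.order \<theta> (char_poly L))"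

lemma vertex_enum:
  assumes "finite (pverts G)"
  shows "distinct (vertex_enum G)" "set (vertex_enum G) = pverts G"
  using someI_ex[of "\<lambda>vs. distinct vs \<and> set vs = pverts G"] finite_distinct_list[OF assms]
  unfolding vertex_enum_def by blast+

lemma laplacian_mat_carrier:
  "laplacian_mat vs G \<in> carrier_mat (length vs) (length vs)"
  by (auto simp: laplacian_mat_def degree_mat_def adjacency_mat_def)

lemma laplacian_mat_similar:
  assumes "distinct vs" "distinct ws" "set vs = set ws"
  shows "similar_mat (laplacian_mat vs G) (laplacian_mat ws G)"
proof -
  define n where "n = length vs"
  have n': "length ws = n"
    using assms by (metis distinct_card n_def)
  have "\<forall>i<n. \<exists>k<n. ws ! k = vs ! i"
    using assms(3) n' unfolding n_def by (metis in_set_conv_nth)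
  then obtain p where p: "\<And>i. i < n \<Longrightarrow> p i < n" "\<And>i. i < n \<Longrightarrow> ws ! p i = vs ! i"
    by metis
  have pinj: "p i = p j \<longleftrightarrow> i = j" if "i < n" "j < n" for i j
    using p that assms(1) unfolding n_def by (metis nth_eq_iff_index_eq)
  define P :: "real mat" where "P = mat n n (\<lambda>(i, k). if k = p i then 1 else 0)"
  define Q :: "real mat" where "Q = mat n n (\<lambda>(k, i). if k = p i then 1 else 0)"
  let ?A = "laplacian_mat vs G" and ?B = "laplacian_mat ws G"
  have carr: "P \<in> carrier_mat n n" "Q \<in> carrier_mat n n"
      "?A \<in> carrier_mat n n" "?B \<in> carrier_mat n n"
    using laplacian_mat_carrier[of vs G] laplacian_mat_carrier[of ws G] n'
    by (auto simp: P_def Q_def n_def)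
  have PQ: "P * Q = 1\<^sub>m n"
  proof (rule eq_matI)
    fix i j assume ij: "i < dim_row (1\<^sub>m n :: real mat)" "j < dim_col (1\<^sub>m n :: real mat)"
    then have "(P * Q) $$ (i, j) = (\<Sum>k\<in>{0..<n}. (if k = p i then 1 else 0) * (if k = p j then 1 else 0))"
      by (simp add: P_def Q_def scalar_prod_def)
    also have "\<dots> = (\<Sum>k\<in>{0..<n}. if k = p i then (if p i = p j then 1 else 0) else 0)"
      by (rule sum.cong) auto
    also have "\<dots> = 1\<^sub>m n $$ (i, j)"
      using ij p pinj by simp
    finally show "(P * Q) $$ (i, j) = 1\<^sub>m n $$ (i, j)" .
  qed (auto simp: P_def Q_def)
  have QP: "Q * P = 1\<^sub>m n"
    using mat_mult_left_right_inverse[OF carr(1,2) PQ] .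
  have PB: "(P * ?B) $$ (i, l) = ?B $$ (p i, l)" if "i < n" "l < n" for i l
  proof -
    have "(P * ?B) $$ (i, l) = (\<Sum>k\<in>{0..<n}. (if k = p i then 1 else 0) * ?B $$ (k, l))"
      using that carr by (simp add: P_def scalar_prod_def)
    also have "\<dots> = (\<Sum>k\<in>{0..<n}. if k = p i then ?B $$ (p i, l) else 0)"
      by (rule sum.cong) auto
    finally show ?thesis
      using that p by simp
  qed
  have "?A = P * ?B * Q"
  proof (rule eq_matI)
    fix i j assume "i < dim_row (P * ?B * Q)" "j < dim_col (P * ?B * Q)"
    then have ij: "i < n" "j < n"
      using carr by auto
    have "(P * ?B * Q) $$ (i, j) = (\<Sum>l\<in>{0..<n}. (P * ?B) $$ (i, l) * (if l = p j then 1 else 0))"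
      using ij carr by (simp add: Q_def scalar_prod_def)
    also have "\<dots> = (\<Sum>l\<in>{0..<n}. if l = p j then ?B $$ (p i, p j) else 0)"
      by (rule sum.cong) (auto simp: PB ij p)
    also have "\<dots> = ?B $$ (p i, p j)"
      using ij p by simp
    also have "\<dots> = ?A $$ (i, j)"
      using ij p pinj n' n_def
      by (simp add: laplacian_mat_def degree_mat_def adjacency_mat_def)
    finally show "?A $$ (i, j) = (P * ?B * Q) $$ (i, j)" ..
  qed (use carr in auto)
  then show ?thesis
    using similar_matI[of ?A ?B P Q n] carr PQ QP by auto
qed

lemma laplacian_count_enum:
  assumes "finite (pverts G)" "distinct vs" "set vs = pverts G"
  shows "laplacian_count G I =
    (\<Sum>\<theta> | \<theta> \<in> I \<and> eigenvalue (laplacian_mat vs G) \<theta>.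
       Polynomial.order \<theta> (char_poly (laplacian_mat vs G)))"
proof -
  have "char_poly (laplacian_mat (vertex_enum G) G) = char_poly (laplacian_mat vs G)"
    using assms by (intro char_poly_similar laplacian_mat_similar) (simp_all add: vertex_enum)
  then show ?thesis
    unfolding laplacian_count_def Let_def
    by (simp add: eigenvalue_root_char_poly[OF laplacian_mat_carrier])
qed

lemma pair_graph_graph_complement:
  assumes "pair_graph G"
  shows "pair_graph (graph_complement G)"
proof -
  interpret pair_graph G by fact
  have sym: "(v, u) \<in> parcs G" if "(u, v) \<in> parcs G" for u v
    using pair_sym_arcs that by (auto simp: symmetric_def dest: symD)
  have fin: "finite (parcs (graph_complement G))"
    by (rule finite_subset[of _ "pverts G \<times> pverts G"])
       (auto simp: graph_complement_def pair_finite_verts)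
  show ?thesis
    using fin pair_finite_verts
    by unfold_locales (auto simp: graph_complement_def symmetric_def intro!: symI dest: sym)
qed

end

theory Submission
  imports Defs "Jordan_Normal_Form.Jordan_Normal_Form"
begin

text \<open>
  The Laplacians \<open>L\<close> of \<open>G\<close> and \<open>K\<close> of its complement satisfy \<open>L + K = n I - J\<close>, so they
  are diagonalised by a common orthonormal basis starting with the constant vector: on the constant
  vector both eigenvalues are 0, on the other basis vectors they are \<open>\<theta>\<close> and \<open>n - \<theta>\<close>. For
  \<open>n \<ge> 2\<close> at most one of \<open>\<theta>\<close>, \<open>n - \<theta>\<close> is below 1, which gives the bound.

  If equality holds, then every \<open>\<theta>\<close> is below 1 or above \<open>n - 1\<close>, so \<open>\<theta> (n - \<theta>) < n - 1\<close> and the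
  integer matrix \<open>M = (n - 1) I - L K\<close> is positive definite. Its diagonal entry at a vertex of
  degree \<open>d\<close> is \<open>n - 1 - d (n - 1 - d)\<close>. At a vertex \<open>u\<close> which is neither isolated nor adjacent to
  all others this is at most 1, hence equal to 1, and positive definiteness together with integrality
  makes the remaining entries of row \<open>u\<close> vanish. But all row sums of \<open>M\<close> are \<open>n - 1\<close>, so \<open>n = 2\<close>,
  which leaves no room for such a vertex.
\<close>

section \<open>Orthogonal diagonalisation of real symmetric matrices\<close>

text \<open>The basis \<open>Q\<close> and the eigenvalues \<open>f\<close> are explicit, so that
  two matrices sharing an eigenbasis can be expressed by the same \<open>Q\<close> with different
  \<open>f\<close>.\<close>

definition orth_diag :: "nat \<Rightarrow> real mat \<Rightarrow> real mat \<Rightarrow> (nat \<Rightarrow> real) \<Rightarrow> bool" where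
  "orth_diag n A Q f \<longleftrightarrow>
     Q \<in> carrier_mat n n \<and> Q\<^sup>T * Q = 1\<^sub>m n \<and> Q\<^sup>T * A * Q = mat_diag n f"

lemma mult_mat_unit_vec:
  fixes A :: "real mat"
  assumes "A \<in> carrier_mat m n" "i < n"
  shows "A *\<^sub>v unit_vec n i = col A i"
  using assms by (intro eq_vecI) auto

text \<open>\<open>H\<close> is the reflection in the hyperplane orthogonal to \<open>u\<close>, the
  difference of \<open>v\<close> and the first unit vector; it swaps these two unit vectors.\<close>

lemma householder:
  fixes v :: "real vec"
  assumes v: "v \<in> carrier_vec (Suc n)" and vv: "v \<bullet> v = 1"
  shows "\<exists>H. H \<in> carrier_mat (Suc n) (Suc n) \<and> H\<^sup>T = H \<and> H * H = 1\<^sub>m (Suc n)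
    \<and> H *\<^sub>v unit_vec (Suc n) 0 = v"
proof -
  let ?N = "Suc n"
  define u where "u = v - unit_vec ?N 0"
  have u: "u \<in> carrier_vec ?N" and [simp]: "dim_vec u = ?N" "dim_vec v = ?N"
    using v by (auto simp: u_def)
  define s where "s = (\<Sum>k<?N. u $ k * u $ k)"
  \<comment> \<open>If \<open>v\<close> is the first unit vector then \<open>s = 0\<close>, so \<open>c = 0\<close> and \<open>H\<close> is the identity.\<close>
  define c where "c = 2 / s"
  define H where "H = mat ?N ?N (\<lambda>(i, j). (if i = j then 1 else 0) - c * u $ i * u $ j)"
  have H: "H \<in> carrier_mat ?N ?N" by (simp add: H_def)
  have sym: "H\<^sup>T = H"
    by (rule eq_matI) (auto simp: H_def)
  have vsum: "(\<Sum>k<?N. v $ k * v $ k) = 1"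
    using vv by (simp add: scalar_prod_def atLeast0LessThan)
  have ui: "u $ i = v $ i - (if i = 0 then 1 else 0)" if "i < ?N" for i
    using that v by (simp add: u_def)
  have s: "s = 2 - 2 * v $ 0"
  proof -
    have "s = (\<Sum>k<?N. v $ k * v $ k) - (\<Sum>k<?N. if k = 0 then 2 * v $ 0 - 1 else 0)"
      unfolding s_def sum_subtractf[symmetric] by (rule sum.cong) (auto simp: ui algebra_simps)
    then show ?thesis using vsum by simp
  qed
  \<comment> \<open>With \<open>H\<close> = I - c u u^T, the square of \<open>H\<close> is I - (2c -
    c^2 s) u u^T, so this identity makes \<open>H\<close> an involution.\<close>
  have cs: "c * c * s = 2 * c"
    by (simp add: c_def)
  have HH: "H * H = 1\<^sub>m ?N"
  proof (rule eq_matI)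
    fix i j assume "i < dim_row (1\<^sub>m ?N :: real mat)" "j < dim_col (1\<^sub>m ?N :: real mat)"
    then have ij: "i < ?N" "j < ?N" by auto
    have "(H * H) $$ (i, j) = (\<Sum>k<?N. ((if i = k then 1 else 0) - c * u $ i * u $ k) *
        ((if k = j then 1 else 0) - c * u $ k * u $ j))"
      using ij by (simp add: H_def scalar_prod_def atLeast0LessThan)
    also have "\<dots> = (\<Sum>k<?N. (if k = i then (if i = j then 1 else 0) - c * u $ i * u $ j else 0)
        - (if k = j then c * u $ i * u $ j else 0) + c * c * (u $ k * u $ k) * (u $ i * u $ j))"
      by (rule sum.cong) (auto simp: algebra_simps)
    also have "\<dots> = (if i = j then 1 else 0) - 2 * c * (u $ i * u $ j) + c * c * s * (u $ i * u $ j)"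
      unfolding sum.distrib sum_subtractf s_def sum_distrib_left[symmetric] sum_distrib_right[symmetric]
      using ij by (simp add: algebra_simps)
    also have "\<dots> = 1\<^sub>m ?N $$ (i, j)"
      using ij cs by simp
    finally show "(H * H) $$ (i, j) = 1\<^sub>m ?N $$ (i, j)" .
  qed (auto simp: H_def)
  have "H *\<^sub>v unit_vec ?N 0 = v"
  proof (rule eq_vecI)
    fix i assume "i < dim_vec v"
    then have i: "i < ?N" by simp
    have "(H *\<^sub>v unit_vec ?N 0) $ i = (if i = 0 then 1 else 0) - c * u $ i * u $ 0"
      using i by (simp add: H_def)
    also have "\<dots> = v $ i"
    proof (cases "s = 0")
      case True
      then have "u $ k * u $ k = 0" if "k < ?N" for k
        using that unfolding s_def by (subst (asm) sum_nonneg_eq_0_iff) auto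
      then have "u $ i = 0" using i by simp
      then show ?thesis using ui[OF i] True by (auto simp: c_def)
    next
      case False
      have "u $ 0 = - s / 2" using ui[of 0] s by simp
      then have "c * u $ 0 = -1" using False by (simp add: c_def)
      then have "c * u $ i * u $ 0 = - u $ i"
        by (metis mult.commute mult.left_commute mult_minus1)
      then show ?thesis using ui[OF i] by simp
    qed
    finally show "(H *\<^sub>v unit_vec ?N 0) $ i = v $ i" .
  qed (use H in auto)
  then show ?thesis using H sym HH by blast
qed

text \<open>The fundamental theorem of algebra gives a complex eigenvalue. Symmetry makes it real,
  so it is a root of the real characteristic polynomial and has a real eigenvector, which is then
  normalised.\<close>

lemma real_symmetric_eigenvector:
  fixes A :: "real mat"
  assumes A: "A \<in> carrier_mat n n" and sym: "A\<^sup>T = A" and n: "n > 0"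
  shows "\<exists>v e. v \<in> carrier_vec n \<and> v \<bullet> v = 1 \<and> A *\<^sub>v v = e \<cdot>\<^sub>v v"
proof -
  let ?B = "map_mat complex_of_real A"
  have B: "?B \<in> carrier_mat n n" using A by simp
  have "degree (char_poly ?B) = n" using degree_monic_char_poly[OF B] by simp
  then have "\<not> constant (poly (char_poly ?B))"
    using n by (simp add: constant_degree)
  then obtain z where "poly (char_poly ?B) z = 0"
    using fundamental_theorem_of_algebra by blast
  then have "eigenvalue ?B z" using eigenvalue_root_char_poly[OF B] by simp
  then obtain w where "eigenvector ?B w z" by (auto simp: eigenvalue_def)
  then have w: "w \<in> carrier_vec n" "w \<noteq> 0\<^sub>v n" "?B *\<^sub>v w = z \<cdot>\<^sub>v w"
    using A by (auto simp: eigenvector_def)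
  have Aij: "A $$ (i, j) = A $$ (j, i)" if "i < n" "j < n" for i j
    using arg_cong[OF sym, of "\<lambda>M. M $$ (i, j)"] that A by simp
  have wi: "(\<Sum>j<n. complex_of_real (A $$ (i, j)) * w $ j) = z * w $ i" if "i < n" for i
  proof -
    have "(?B *\<^sub>v w) $ i = (z \<cdot>\<^sub>v w) $ i" using w by simp
    then show ?thesis using that w(1) A by (simp add: scalar_prod_def atLeast0LessThan)
  qed
  \<comment> \<open>\<open>S\<close> is the squared norm of \<open>w\<close> and \<open>T\<close>
    the Hermitian form of \<open>A\<close> at \<open>w\<close>. Then \<open>T = z * S\<close>, where
    \<open>T\<close> is real by symmetry and \<open>S\<close> is real and nonzero, so
    \<open>z\<close> is real.\<close>
  define S where "S = (\<Sum>i<n. w $ i * cnj (w $ i))"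
  define T where "T = (\<Sum>i<n. \<Sum>j<n. complex_of_real (A $$ (i, j)) * w $ j * cnj (w $ i))"
  have T: "T = z * S"
    unfolding T_def S_def sum_distrib_left using wi
    by (auto intro!: sum.cong simp: sum_distrib_right[symmetric] mult.assoc[symmetric])
  have "cnj T = (\<Sum>i<n. \<Sum>j<n. complex_of_real (A $$ (i, j)) * cnj (w $ j) * w $ i)"
    by (simp add: T_def)
  also have "\<dots> = (\<Sum>j<n. \<Sum>i<n. complex_of_real (A $$ (i, j)) * cnj (w $ j) * w $ i)"
    by (rule sum.swap)
  also have "\<dots> = T"
    unfolding T_def by (intro sum.cong refl) (simp add: Aij mult_ac)
  finally have "cnj T = T" .
  moreover have Sr: "S = complex_of_real (\<Sum>i<n. (cmod (w $ i))\<^sup>2)"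
    by (simp add: S_def complex_norm_square[symmetric])
  moreover have S0: "S \<noteq> 0"
  proof
    assume "S = 0"
    then have "(\<Sum>i<n. (cmod (w $ i))\<^sup>2) = 0" using Sr by (metis of_real_eq_0_iff)
    then have "\<forall>i<n. w $ i = 0" by (subst (asm) sum_nonneg_eq_0_iff) auto
    then have "w = 0\<^sub>v n" using w(1) by (intro eq_vecI) auto
    then show False using w(2) by simp
  qed
  ultimately have "cnj z = z"
    using T by (metis complex_cnj_complex_of_real complex_cnj_mult mult_right_cancel)
  then obtain e where z: "z = complex_of_real e"
    by (metis Reals_cnj_iff Reals_cases)
  have "poly (char_poly A) e = 0"
    using \<open>poly (char_poly ?B) z = 0\<close>
    unfolding z of_real_hom.char_poly_hom[OF A] by simp
  then have "eigenvalue A e" using eigenvalue_root_char_poly[OF A] by simp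
  then obtain x where "eigenvector A x e" by (auto simp: eigenvalue_def)
  then have x: "x \<in> carrier_vec n" "x \<noteq> 0\<^sub>v n" "A *\<^sub>v x = e \<cdot>\<^sub>v x"
    using A by (auto simp: eigenvector_def)
  have "x \<bullet> x > 0"
    using x conjugate_square_greater_0_vec[OF x(1)] by simp
  define v where "v = (1 / sqrt (x \<bullet> x)) \<cdot>\<^sub>v x"
  have "v \<in> carrier_vec n" using x by (simp add: v_def)
  moreover have "v \<bullet> v = 1"
    using x(1) \<open>x \<bullet> x > 0\<close> by (simp add: v_def)
  moreover have "A *\<^sub>v v = e \<cdot>\<^sub>v v"
    using x A by (simp add: v_def mult_mat_vec smult_smult_assoc mult.commute)
  ultimately show ?thesis by blast
qed

text \<open>Deflation: a reflection splits off the eigenvector, and the remaining block is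
  diagonalised by \<open>IH\<close>. Taking \<open>IH\<close> as an assumption lets the lemma serve
  both the induction and, afterwards, the version with a prescribed first column.\<close>

lemma orth_diag_extend:
  fixes A :: "real mat"
  assumes A: "A \<in> carrier_mat (Suc n) (Suc n)" and sym: "A\<^sup>T = A"
    and v: "v \<in> carrier_vec (Suc n)" "v \<bullet> v = 1" "A *\<^sub>v v = e \<cdot>\<^sub>v v"
    and IH: "\<And>A'. A' \<in> carrier_mat n n \<Longrightarrow> A'\<^sup>T = A' \<Longrightarrow> \<exists>Q f. orth_diag n A' Q f"
  shows "\<exists>Q f. orth_diag (Suc n) A Q f \<and> col Q 0 = v \<and> f 0 = e"
proof -
  let ?N = "Suc n"
  obtain H where H: "H \<in> carrier_mat ?N ?N" "H\<^sup>T = H" "H * H = 1\<^sub>m ?N"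
      "H *\<^sub>v unit_vec ?N 0 = v"
    using householder[OF v(1,2)] by blast
  define B where "B = H * A * H"
  have B: "B \<in> carrier_mat ?N ?N" using H A by (simp add: B_def)
  have BT: "B\<^sup>T = B"
    unfolding B_def using H(1,2) A sym
    by (subst transpose_mult[of _ ?N ?N _ ?N], simp, simp, subst transpose_mult[of _ ?N ?N _ ?N])
       (simp_all add: assoc_mult_mat[of _ ?N ?N _ ?N _ ?N])
  \<comment> \<open>As \<open>H\<close> swaps \<open>v\<close> and the first unit vector, the latter
    is an eigenvector of \<open>B\<close>. This clears the first column of \<open>B\<close> below
    the diagonal, and symmetry clears the first row.\<close>
  have Hv: "H *\<^sub>v v = unit_vec ?N 0"
    unfolding H(4)[symmetric] using H(1,3) by (simp add: assoc_mult_mat_vec[of _ ?N ?N _ ?N, symmetric])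
  have Be: "B *\<^sub>v unit_vec ?N 0 = e \<cdot>\<^sub>v unit_vec ?N 0"
    using H A v Hv by (simp add: B_def assoc_mult_mat_vec[of _ ?N ?N _ ?N] mult_mat_vec)
  have B0: "B $$ (i, 0) = (if i = 0 then e else 0)" if "i < ?N" for i
    using arg_cong[OF Be, of "\<lambda>x. x $ i"] that B by simp
  have Bsym: "B $$ (i, j) = B $$ (j, i)" if "i < ?N" "j < ?N" for i j
    using arg_cong[OF BT, of "\<lambda>M. M $$ (i, j)"] that B by simp
  define A' where "A' = mat n n (\<lambda>(i, j). B $$ (Suc i, Suc j))"
  have A': "A' \<in> carrier_mat n n" by (simp add: A'_def)
  have "A'\<^sup>T = A'" by (rule eq_matI) (auto simp: A'_def Bsym)
  then obtain Q' f' where "orth_diag n A' Q' f'" using IH[OF A'] by blast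
  then have Q': "Q' \<in> carrier_mat n n" "Q'\<^sup>T * Q' = 1\<^sub>m n" "Q'\<^sup>T * A' * Q' = mat_diag n f'"
    by (auto simp: orth_diag_def)
  define D where "D = mat 1 1 (\<lambda>_. e)"
  have D: "D \<in> carrier_mat 1 1" by (simp add: D_def)
  define P where "P = four_block_mat (1\<^sub>m 1) (0\<^sub>m 1 n) (0\<^sub>m n 1) Q'"
  have P: "P \<in> carrier_mat ?N ?N"
    unfolding P_def using four_block_carrier_mat[of "1\<^sub>m 1" 1 1 Q' n n] Q' by simp
  have PT: "P\<^sup>T = four_block_mat (1\<^sub>m 1) (0\<^sub>m 1 n) (0\<^sub>m n 1) (Q'\<^sup>T)"
    unfolding P_def using Q'(1) by (subst transpose_four_block_mat) auto
  have Bb: "B = four_block_mat D (0\<^sub>m 1 n) (0\<^sub>m n 1) A'"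
  proof (rule eq_matI)
    fix i j assume "i < dim_row (four_block_mat D (0\<^sub>m 1 n) (0\<^sub>m n 1) A')"
      "j < dim_col (four_block_mat D (0\<^sub>m 1 n) (0\<^sub>m n 1) A')"
    then have ij: "i < ?N" "j < ?N" using D A' by auto
    show "B $$ (i, j) = four_block_mat D (0\<^sub>m 1 n) (0\<^sub>m n 1) A' $$ (i, j)"
      using ij B0[of i] B0[of j] Bsym[of 0 j] A' D
      by (cases i; cases j) (auto simp: D_def A'_def)
  qed (use B D A' in auto)
  have PP: "P\<^sup>T * P = 1\<^sub>m ?N"
    unfolding PT unfolding P_def using Q'
    by (subst mult_four_block_mat) (auto simp: four_block_one_mat[of 1 n, simplified])
  have PBP: "P\<^sup>T * B * P = mat_diag ?N (case_nat e f')"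
  proof -
    have "P\<^sup>T * B = four_block_mat D (0\<^sub>m 1 n) (0\<^sub>m n 1) (Q'\<^sup>T * A')"
      unfolding PT Bb using Q' D A' by (subst mult_four_block_mat) auto
    then have "P\<^sup>T * B * P = four_block_mat D (0\<^sub>m 1 n) (0\<^sub>m n 1) (mat_diag n f')"
      unfolding P_def using Q' D A' by (auto simp: mult_four_block_mat[of _ 1 1 _ n _ n _ _ 1 _ n])
    also have "\<dots> = mat_diag ?N (case_nat e f')"
      by (rule eq_matI) (auto simp: D_def mat_diag_def split: nat.split)
    finally show ?thesis .
  qed
  define Q where "Q = H * P"
  have Q: "Q \<in> carrier_mat ?N ?N" using H P by (simp add: Q_def)
  have QT: "Q\<^sup>T = P\<^sup>T * H" using H P by (simp add: Q_def transpose_mult[of _ ?N ?N])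
  have "Q\<^sup>T * Q = P\<^sup>T * (H * H) * P"
    unfolding QT unfolding Q_def using H(1) P by (simp add: assoc_mult_mat[of _ ?N ?N _ ?N _ ?N])
  then have QQ: "Q\<^sup>T * Q = 1\<^sub>m ?N" using H(3) P PP by simp
  have "Q\<^sup>T * A * Q = P\<^sup>T * B * P"
    unfolding QT unfolding Q_def B_def using H(1) P A by (simp add: assoc_mult_mat[of _ ?N ?N _ ?N _ ?N])
  then have QAQ: "Q\<^sup>T * A * Q = mat_diag ?N (case_nat e f')" using PBP by simp
  have "col P 0 = unit_vec ?N 0"
    using Q'(1) by (intro eq_vecI) (auto simp: P_def)
  moreover have "col Q 0 = H *\<^sub>v col P 0"
    unfolding Q_def by (rule col_mult2[OF H(1) P]) simp
  ultimately have "col Q 0 = v"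
    using H(4) by simp
  then show ?thesis
    using Q QQ QAQ by (intro exI[of _ Q] exI[of _ "case_nat e f'"]) (simp add: orth_diag_def)
qed

theorem real_symmetric_orth_diag:
  fixes A :: "real mat"
  assumes "A \<in> carrier_mat n n" "A\<^sup>T = A"
  shows "\<exists>Q f. orth_diag n A Q f"
  using assms
proof (induction n arbitrary: A)
  case 0
  have "orth_diag 0 A (1\<^sub>m 0) (\<lambda>_. 0)"
    using 0 by (auto simp: orth_diag_def mat_diag_def)
  then show ?case by blast
next
  case (Suc n)
  then show ?case
    using real_symmetric_eigenvector[of A "Suc n"] orth_diag_extend[of A n] by (metis zero_less_Suc)
qed

lemma orth_diag_with_eigenvector:
  fixes A :: "real mat"
  assumes A: "A \<in> carrier_mat n n" "A\<^sup>T = A" and n: "n > 0"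
    and v: "v \<in> carrier_vec n" "v \<bullet> v = 1" "A *\<^sub>v v = e \<cdot>\<^sub>v v"
  shows "\<exists>Q f. orth_diag n A Q f \<and> col Q 0 = v \<and> f 0 = e"
proof -
  obtain m where m: "n = Suc m" using n by (cases n) auto
  show ?thesis
    unfolding m by (rule orth_diag_extend[OF A[unfolded m] v[unfolded m]]) (rule real_symmetric_orth_diag)
qed

section \<open>Orthogonally diagonalised matrices\<close>

lemma orth_diag_right_inverse:
  assumes "orth_diag n A Q f"
  shows "Q * Q\<^sup>T = 1\<^sub>m n"
  using assms mat_mult_left_right_inverse[of "Q\<^sup>T" n Q] by (auto simp: orth_diag_def)

lemma orth_diag_eq:
  assumes A: "A \<in> carrier_mat n n" and "orth_diag n A Q f"
  shows "A = Q * mat_diag n f * Q\<^sup>T"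
proof -
  have Q: "Q \<in> carrier_mat n n" "Q\<^sup>T * A * Q = mat_diag n f"
    using assms(2) by (auto simp: orth_diag_def)
  have "Q * (Q\<^sup>T * A * Q) * Q\<^sup>T = (Q * Q\<^sup>T) * A * (Q * Q\<^sup>T)"
    using Q(1) A by (simp add: assoc_mult_mat[of _ n n _ n _ n])
  then show ?thesis
    using orth_diag_right_inverse[OF assms(2)] Q A by simp
qed

section \<open>Multiplicities of eigenvalues as counts of diagonal entries\<close>

lemma order_prod_linear:
  "Polynomial.order a (\<Prod>x\<leftarrow>xs. [:- x, 1:]) = length (filter (\<lambda>x. x = a) xs)"
proof (induction xs)
  case (Cons x xs)
  have nz: "(\<Prod>x\<leftarrow>xs. [:- x, 1:]) \<noteq> 0" by (induction xs) (simp_all del: mult_pCons_left)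
  then show ?case
    using Cons by (simp add: order_mult order_linear' del: mult_pCons_left)
qed simp

lemma order_char_poly_orth_diag:
  assumes A: "A \<in> carrier_mat n n" and od: "orth_diag n A Q f"
  shows "Polynomial.order a (char_poly A) = card {i. i < n \<and> f i = a}"
proof -
  have Q: "Q \<in> carrier_mat n n" "Q\<^sup>T * Q = 1\<^sub>m n" using od by (auto simp: orth_diag_def)
  have "similar_mat A (mat_diag n f)"
    by (rule similar_matI[of _ _ Q "Q\<^sup>T" n])
       (use Q A orth_diag_right_inverse[OF od] orth_diag_eq[OF A od] in auto)
  then have "char_poly A = char_poly (mat_diag n f)" by (rule char_poly_similar)
  also have "\<dots> = (\<Prod>a\<leftarrow>diag_mat (mat_diag n f). [:- a, 1:])"
    by (rule char_poly_upper_triangular[of _ n]) (auto simp: mat_diag_def)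
  also have "diag_mat (mat_diag n f) = map f [0..<n]"
    by (auto simp: diag_mat_def mat_diag_def)
  finally have "Polynomial.order a (char_poly A) = length (filter (\<lambda>x. x = a) (map f [0..<n]))"
    by (simp only: order_prod_linear)
  also have "\<dots> = card {i. i < n \<and> f i = a}"
    by (auto simp: length_filter_conv_card intro!: arg_cong[of _ _ card])
  finally show ?thesis .
qed

text \<open>Indices are grouped by their value under \<open>f\<close>. Eigenvalue counts of matrices
  with the same \<open>Q\<close> thus become cardinalities of index sets that can be intersected and
  united.\<close>

lemma sum_order_char_poly_orth_diag:
  assumes A: "A \<in> carrier_mat n n" and od: "orth_diag n A Q f"
  shows "(\<Sum>\<theta> | \<theta> \<in> I \<and> eigenvalue A \<theta>. Polynomial.order \<theta> (char_poly A))
    = card {i. i < n \<and> f i \<in> I}"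
proof -
  let ?S = "{i. i < n \<and> f i \<in> I}"
  have "char_poly A \<noteq> 0" using degree_monic_char_poly[OF A] by auto
  then have ev: "eigenvalue A \<theta> \<longleftrightarrow> \<theta> \<in> f ` {..<n}" for \<theta>
    using eigenvalue_root_char_poly[OF A, of \<theta>] order_char_poly_orth_diag[OF A od, of \<theta>]
    by (auto simp: order_root)
  have "(\<Sum>\<theta> | \<theta> \<in> I \<and> eigenvalue A \<theta>. Polynomial.order \<theta> (char_poly A))
      = (\<Sum>\<theta>\<in>f ` ?S. card {i \<in> ?S. f i = \<theta>})"
    by (rule sum.cong) (auto simp: ev order_char_poly_orth_diag[OF A od] intro!: arg_cong[of _ _ card])
  also have "\<dots> = card ?S"
    using sum.image_gen[of ?S "\<lambda>_. 1 :: nat" f] by simp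
  finally show ?thesis .
qed

text \<open>The identity \<open>Q * Q\<^sup>T\<close> is inserted between the factors. With the next
  lemma this diagonalises the matrix \<open>M\<close> below.\<close>

lemma orth_diag_mult:
  assumes A: "A \<in> carrier_mat n n" "orth_diag n A Q f" and B: "B \<in> carrier_mat n n" "orth_diag n B Q g"
  shows "orth_diag n (A * B) Q (\<lambda>i. f i * g i)"
proof -
  have Q: "Q \<in> carrier_mat n n" using A by (auto simp: orth_diag_def)
  have "Q\<^sup>T * (A * B) * Q = Q\<^sup>T * A * (Q * Q\<^sup>T) * B * Q"
    unfolding orth_diag_right_inverse[OF A(2)]
    using Q A B by (simp add: assoc_mult_mat[of _ n n _ n _ n])
  also have "\<dots> = (Q\<^sup>T * A * Q) * (Q\<^sup>T * B * Q)"
    using Q A B by (simp add: assoc_mult_mat[of _ n n _ n _ n])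
  finally show ?thesis using A B by (simp add: orth_diag_def)
qed

lemma orth_diag_scalar_minus:
  assumes A: "A \<in> carrier_mat n n" "orth_diag n A Q f"
  shows "orth_diag n (c \<cdot>\<^sub>m 1\<^sub>m n - A) Q (\<lambda>i. c - f i)"
proof -
  have Q: "Q \<in> carrier_mat n n" "Q\<^sup>T * Q = 1\<^sub>m n" "Q\<^sup>T * A * Q = mat_diag n f"
    using A by (auto simp: orth_diag_def)
  have "Q\<^sup>T * (c \<cdot>\<^sub>m 1\<^sub>m n - A) * Q = c \<cdot>\<^sub>m (Q\<^sup>T * Q) - Q\<^sup>T * A * Q"
    using Q(1) A by (simp add: mult_minus_distrib_mat[of _ n n _ n] minus_mult_distrib_mat[of _ n n _ _ n]
        mult_smult_distrib[of _ n n _ n] mult_smult_assoc_mat[of _ n n _ n])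
  also have "\<dots> = mat_diag n (\<lambda>i. c - f i)"
    unfolding Q by (rule eq_matI) (auto simp: mat_diag_def)
  finally show ?thesis using Q by (simp add: orth_diag_def)
qed

text \<open>Meant for \<open>M\<close>, which contains a product of two symmetric matrices: such a
  product is symmetric only if they commute, and a common eigenbasis ensures that.\<close>

lemma orth_diag_symmetric:
  assumes A: "A \<in> carrier_mat n n" "orth_diag n A Q f"
  shows "A\<^sup>T = A"
proof -
  have Q: "Q \<in> carrier_mat n n" using A by (auto simp: orth_diag_def)
  have D: "(mat_diag n f)\<^sup>T = mat_diag n f" by (rule eq_matI) (auto simp: mat_diag_def)
  have "(Q * mat_diag n f * Q\<^sup>T)\<^sup>T = Q * mat_diag n f * Q\<^sup>T"
    using Q D
    by (subst transpose_mult[of _ n n _ n], simp, simp, subst transpose_mult[of _ n n _ n])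
       (simp_all add: assoc_mult_mat[of _ n n _ n _ n])
  then show ?thesis using orth_diag_eq[OF A] by simp
qed

text \<open>In the coordinates \<open>y\<close> of \<open>x\<close> with respect to the columns of
  \<open>Q\<close>, the form is the sum of the \<open>f i * (y $ i)\<^sup>2\<close>.\<close>

lemma orth_diag_pos:
  assumes A: "A \<in> carrier_mat n n" "orth_diag n A Q f"
    and pos: "\<And>i. i < n \<Longrightarrow> f i > 0" and x: "x \<in> carrier_vec n" "x \<noteq> 0\<^sub>v n"
  shows "x \<bullet> (A *\<^sub>v x) > 0"
proof -
  have Q: "Q \<in> carrier_mat n n" using A by (auto simp: orth_diag_def)
  define y where "y = Q\<^sup>T *\<^sub>v x"
  have y: "y \<in> carrier_vec n" using Q x by (simp add: y_def)
  have xy: "Q *\<^sub>v y = x"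
    unfolding y_def using Q x orth_diag_right_inverse[OF A(2)]
    by (simp add: assoc_mult_mat_vec[of _ n n _ n, symmetric])
  have "y \<noteq> 0\<^sub>v n"
  proof
    assume "y = 0\<^sub>v n"
    then have "x = 0\<^sub>v n" using xy Q by auto
    then show False using x by simp
  qed
  then obtain k where k: "k < n" "y $ k \<noteq> 0" using y by (metis carrier_vecD eq_vecI index_zero_vec)
  have Dy: "(mat_diag n f *\<^sub>v y) $ i = f i * y $ i" if "i < n" for i
  proof -
    have "(mat_diag n f *\<^sub>v y) $ i = (\<Sum>j<n. (if i = j then f j else 0) * y $ j)"
      using that y by (simp add: mat_diag_def scalar_prod_def atLeast0LessThan)
    also have "\<dots> = (\<Sum>j<n. if j = i then f j * y $ j else 0)"
      by (rule sum.cong) auto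
    finally have "(mat_diag n f *\<^sub>v y) $ i = (\<Sum>j<n. if j = i then f j * y $ j else 0)" .
    then show ?thesis using that by simp
  qed
  have "x \<bullet> (A *\<^sub>v x) = x \<bullet> (Q *\<^sub>v (mat_diag n f *\<^sub>v y))"
    by (subst orth_diag_eq[OF A]) (use Q x in \<open>simp add: y_def assoc_mult_mat_vec[of _ n n _ n]\<close>)
  also have "\<dots> = y \<bullet> (mat_diag n f *\<^sub>v y)"
    unfolding y_def using Q x mult_mat_vec_carrier[OF mat_diag_dim y, of f]
    by (subst transpose_vec_mult_scalar[of _ n n, symmetric]) (simp_all add: y_def)
  also have "\<dots> = (\<Sum>i<n. f i * (y $ i)\<^sup>2)"
    unfolding scalar_prod_def using Dy mult_mat_vec_carrier[OF mat_diag_dim y, of f]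
    by (auto simp: atLeast0LessThan power2_eq_square mult_ac simp del: index_mult_mat_vec dim_mult_mat_vec intro!: sum.cong)
  also have "\<dots> > 0"
    using k pos by (intro sum_pos2[of _ k]) (auto simp: less_imp_le)
  finally show ?thesis .
qed

section \<open>Laplacians of zero-one adjacency functions\<close>

text \<open>Real weights on index pairs replace arcs, so that a graph and its complement are
  instances of one construction and degrees are row sums.\<close>

definition lap :: "nat \<Rightarrow> (nat \<Rightarrow> nat \<Rightarrow> real) \<Rightarrow> real mat" where
  "lap n a = mat n n (\<lambda>(i, j). (if i = j then \<Sum>k<n. a i k else 0) - a i j)"

lemma lap_row_sum:
  assumes "i < n"
  shows "(\<Sum>j<n. lap n a $$ (i, j)) = 0"
proof -
  have "(\<Sum>j<n. lap n a $$ (i, j)) = (\<Sum>j<n. (if j = i then \<Sum>k<n. a i k else 0) - a i j)"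
    using assms by (intro sum.cong) (auto simp: lap_def)
  then show ?thesis using assms by (simp add: sum_subtractf)
qed

lemma sum_ge_1:
  fixes h :: "nat \<Rightarrow> real"
  assumes "\<And>k. h k \<ge> 0" "\<And>k. h k \<in> \<int>" "sum h A \<noteq> 0"
  shows "sum h A \<ge> 1"
proof -
  have "sum h A \<ge> 0" "sum h A \<in> \<int>"
    using assms by (auto intro: sum_nonneg Ints_sum)
  then show ?thesis
    using Ints_nonzero_abs_ge1[of "sum h A"] assms(3) by simp
qed

locale adjacency =
  fixes n :: nat and a :: "nat \<Rightarrow> nat \<Rightarrow> real"
  assumes zero_one: "\<And>i j. a i j = 0 \<or> a i j = 1"
    and sym: "\<And>i j. i < n \<Longrightarrow> j < n \<Longrightarrow> a i j = a j i"
    and irrefl: "\<And>i. i < n \<Longrightarrow> a i i = 0"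
begin

definition b :: "nat \<Rightarrow> nat \<Rightarrow> real" where
  "b i j = (if i = j then 0 else 1 - a i j)"

abbreviation L where "L \<equiv> lap n a"
abbreviation K where "K \<equiv> lap n b"
abbreviation d where "d i \<equiv> \<Sum>k<n. a i k"
abbreviation d' where "d' i \<equiv> \<Sum>k<n. b i k"

lemma L: "L \<in> carrier_mat n n" and K: "K \<in> carrier_mat n n"
  by (simp_all add: lap_def)

lemma L_sym: "L\<^sup>T = L"
  by (rule eq_matI) (auto simp: lap_def sym)

lemma d_add_d':
  assumes "i < n"
  shows "d i + d' i = real n - 1"
proof -
  have "d i + d' i = (\<Sum>k<n. 1 - (if k = i then 1 else 0))"
    unfolding sum.distrib[symmetric] using irrefl[OF assms] by (intro sum.cong) (auto simp: b_def)
  then show ?thesis using assms by (simp add: sum_subtractf)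
qed

text \<open>This is \<open>K\<close> = n I - J - \<open>L\<close> entrywise, with J the all-ones
  matrix; the diagonal case is \<open>d_add_d'\<close>.\<close>

lemma K_index:
  assumes "i < n" "j < n"
  shows "K $$ (i, j) = (if i = j then real n else 0) - 1 - L $$ (i, j)"
  using assms d_add_d'[of i] irrefl[of i] by (auto simp: lap_def b_def)

text \<open>J is n times the projection onto the constant unit vector \<open>v\<close>. If
  \<open>v\<close> is the first column of \<open>Q\<close>, then J vanishes on the other columns, so
  a basis diagonalising \<open>L\<close> also diagonalises \<open>K\<close>.\<close>

lemma spectrum:
  assumes n: "n \<ge> 1"
  shows "\<exists>Q f. orth_diag n L Q f \<and> f 0 = 0 \<and> orth_diag n K Q (\<lambda>i. if i = 0 then 0 else real n - f i)"
proof -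
  define v where "v = vec n (\<lambda>_. 1 / sqrt (real n))"
  have v: "v \<in> carrier_vec n" "v \<bullet> v = 1"
    using n by (auto simp: v_def scalar_prod_def)
  have "L *\<^sub>v v = 0 \<cdot>\<^sub>v v"
  proof (rule eq_vecI)
    fix i assume "i < dim_vec (0 \<cdot>\<^sub>v v)"
    then have i: "i < n" by (simp add: v_def)
    then have "(L *\<^sub>v v) $ i = (\<Sum>j<n. L $$ (i, j)) * (1 / sqrt (real n))"
      using L unfolding sum_distrib_right by (simp add: v_def scalar_prod_def atLeast0LessThan)
    then show "(L *\<^sub>v v) $ i = (0 \<cdot>\<^sub>v v) $ i"
      using i by (simp add: lap_row_sum v_def)
  qed (use L in \<open>simp add: v_def\<close>)
  then obtain Q f where od: "orth_diag n L Q f" and Q0: "col Q 0 = v" and f0: "f 0 = 0"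
    using orth_diag_with_eigenvector[OF L L_sym _ v, of 0] n by auto
  have Q: "Q \<in> carrier_mat n n" "Q\<^sup>T * Q = 1\<^sub>m n" "Q\<^sup>T * L * Q = mat_diag n f"
    using od by (auto simp: orth_diag_def)
  have c: "col Q i \<in> carrier_vec n" for i using Q by auto
  have QQ: "col Q i \<bullet> col Q j = (if i = j then 1 else 0)" if "i < n" "j < n" for i j
    using arg_cong[OF Q(2), of "\<lambda>M. M $$ (i, j)"] that Q(1) by simp
  have conj: "(Q\<^sup>T * A * Q) $$ (i, j) = col Q i \<bullet> (A *\<^sub>v col Q j)"
    if "i < n" "j < n" "A \<in> carrier_mat n n" for A i j
  proof -
    have "(Q\<^sup>T * A * Q) $$ (i, j) = row (Q\<^sup>T) i \<bullet> col (A * Q) j"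
      using that Q(1) by (simp add: assoc_mult_mat[of _ n n _ n _ n])
    also have "col (A * Q) j = A *\<^sub>v col Q j"
      using that Q(1) by (intro col_mult2) auto
    finally show ?thesis using that Q(1) by simp
  qed
  \<comment> \<open>All entries of \<open>v\<close> are 1 / sqrt n, so the middle term is J applied
    to \<open>x\<close>.\<close>
  have Kx: "K *\<^sub>v x = real n \<cdot>\<^sub>v x - (real n * (v \<bullet> x)) \<cdot>\<^sub>v v - L *\<^sub>v x"
    if x: "x \<in> carrier_vec n" for x
  proof (rule eq_vecI)
    fix i assume "i < dim_vec (real n \<cdot>\<^sub>v x - (real n * (v \<bullet> x)) \<cdot>\<^sub>v v - L *\<^sub>v x)"
    then have i: "i < n" using L by simp
    have "(K *\<^sub>v x) $ i = (\<Sum>j<n. K $$ (i, j) * x $ j)"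
      using i x K by (simp add: scalar_prod_def atLeast0LessThan)
    also have "\<dots> = (\<Sum>j<n. (if j = i then real n * x $ j else 0) - x $ j - L $$ (i, j) * x $ j)"
      by (rule sum.cong) (auto simp: K_index i algebra_simps)
    also have "\<dots> = real n * x $ i - (\<Sum>j<n. x $ j) - (\<Sum>j<n. L $$ (i, j) * x $ j)"
      using i by (simp add: sum_subtractf)
    also have "(\<Sum>j<n. x $ j) = ((real n * (v \<bullet> x)) \<cdot>\<^sub>v v) $ i"
      using i x n by (simp add: v_def scalar_prod_def atLeast0LessThan sum_divide_distrib[symmetric])
    also have "(\<Sum>j<n. L $$ (i, j) * x $ j) = (L *\<^sub>v x) $ i"
      using i x L by (simp add: scalar_prod_def atLeast0LessThan)
    finally show "(K *\<^sub>v x) $ i = (real n \<cdot>\<^sub>v x - (real n * (v \<bullet> x)) \<cdot>\<^sub>v v - L *\<^sub>v x) $ i"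
      using i x L v by simp
  qed (use K L in auto)
  have "Q\<^sup>T * K * Q = mat_diag n (\<lambda>i. if i = 0 then 0 else real n - f i)"
  proof (rule eq_matI)
    fix i j assume "i < dim_row (mat_diag n (\<lambda>i. if i = 0 then 0 else real n - f i))"
      "j < dim_col (mat_diag n (\<lambda>i. if i = 0 then 0 else real n - f i))"
    then have ij: "i < n" "j < n" by (auto simp: mat_diag_def)
    have "(Q\<^sup>T * K * Q) $$ (i, j) =
        real n * (col Q i \<bullet> col Q j) - real n * (v \<bullet> col Q j) * (col Q i \<bullet> v) - col Q i \<bullet> (L *\<^sub>v col Q j)"
      unfolding conj[OF ij K] Kx[OF c]
      using c[of i] c[of j] v L
      by (simp add: scalar_prod_minus_distrib[of _ n])
    also have "col Q i \<bullet> (L *\<^sub>v col Q j) = mat_diag n f $$ (i, j)"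
      using conj[OF ij L] Q(3) by simp
    \<comment> \<open>By orthonormality the J term survives only at position (0, 0), where it
      cancels n; hence the eigenvalue 0 there instead of n.\<close>
    also have "v \<bullet> col Q j = (if j = 0 then 1 else 0)"
      using QQ[of 0 j] ij n Q0 by auto
    also have "col Q i \<bullet> v = (if i = 0 then 1 else 0)"
      using QQ[of i 0] ij n Q0 by auto
    finally show "(Q\<^sup>T * K * Q) $$ (i, j) = mat_diag n (\<lambda>i. if i = 0 then 0 else real n - f i) $$ (i, j)"
      using ij f0 by (auto simp: QQ mat_diag_def)
  qed (use Q in \<open>auto simp: mat_diag_def\<close>)
  then show ?thesis using od f0 Q by (auto simp: orth_diag_def)
qed

section \<open>The integer matrix (n - 1) I - L K and its positive definiteness\<close>

definition M :: "real mat" where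
  "M = (real n - 1) \<cdot>\<^sub>m 1\<^sub>m n - L * K"

lemma M: "M \<in> carrier_mat n n"
  unfolding M_def by (intro minus_carrier_mat mult_carrier_mat[OF L K])

lemma M_index:
  assumes "i < n" "j < n"
  shows "M $$ (i, j) = (if i = j then real n - 1 else 0) - (\<Sum>k<n. L $$ (i, k) * K $$ (k, j))"
  using assms L K by (simp add: M_def scalar_prod_def atLeast0LessThan)

text \<open>No pair is an edge of both the graph and its complement, so in the diagonal entry of
  \<open>L * K\<close> only the product of the two degrees remains.\<close>

lemma M_diag:
  assumes "i < n"
  shows "M $$ (i, i) = real n - 1 - d i * d' i"
proof -
  have "L $$ (i, k) * K $$ (k, i) = (if k = i then d i * d' i else 0)" if k: "k < n" for k
  proof (cases "k = i")
    case True
    have "a i i = 0" "b i i = 0" using irrefl[OF assms] by (simp_all add: b_def)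
    then show ?thesis using True assms by (simp add: lap_def)
  next
    case False
    then have "L $$ (i, k) * K $$ (k, i) = a i k * b k i"
      using assms k by (simp add: lap_def)
    also have "b k i = 1 - a i k" using False sym[OF assms k] by (simp add: b_def)
    finally show ?thesis using zero_one[of i k] False by auto
  qed
  then have "(\<Sum>k<n. L $$ (i, k) * K $$ (k, i)) = (\<Sum>k<n. if k = i then d i * d' i else 0)"
    by (intro sum.cong) auto
  then show ?thesis using M_index[OF assms assms] assms by simp
qed

text \<open>The rows of \<open>K\<close> sum to 0, so \<open>L * K\<close> contributes
  nothing.\<close>

lemma M_row_sum:
  assumes "i < n"
  shows "(\<Sum>j<n. M $$ (i, j)) = real n - 1"
proof -
  have "(\<Sum>j<n. \<Sum>k<n. L $$ (i, k) * K $$ (k, j)) = 0"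
    by (subst sum.swap) (simp add: sum_distrib_left[symmetric] lap_row_sum)
  then show ?thesis using assms by (simp add: M_index sum_subtractf)
qed

lemma b_zero_one: "b i j = 0 \<or> b i j = 1"
  using zero_one[of i j] by (auto simp: b_def)

lemma a_nonneg: "a i j \<ge> 0" and b_nonneg: "b i j \<ge> 0"
  using zero_one[of i j] b_zero_one[of i j] by auto

lemma a_Ints: "a i j \<in> \<int>" and b_Ints: "b i j \<in> \<int>"
  using zero_one[of i j] b_zero_one[of i j] by auto

lemma d_eq_0_iff: "d i = 0 \<longleftrightarrow> (\<forall>k<n. a i k = 0)"
  and d'_eq_0_iff: "d' i = 0 \<longleftrightarrow> (\<forall>k<n. b i k = 0)"
  using a_nonneg b_nonneg by (auto simp: sum_nonneg_eq_0_iff)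

lemma d_ge_1: "d i \<noteq> 0 \<Longrightarrow> d i \<ge> 1" and d'_ge_1: "d' i \<noteq> 0 \<Longrightarrow> d' i \<ge> 1"
  by (intro sum_ge_1 a_nonneg a_Ints b_nonneg b_Ints; assumption)+

lemma M_Ints:
  assumes "i < n" "j < n"
  shows "M $$ (i, j) \<in> \<int>"
  unfolding M_index[OF assms] lap_def using a_Ints b_Ints assms
  by (auto intro!: Ints_diff Ints_sum Ints_mult)

text \<open>If \<open>w\<close> is isolated, row \<open>w\<close> of \<open>L\<close> is zero, which
  gives the entry at (w, u) and by symmetry the one at (u, w). If \<open>w\<close> is isolated in
  the complement, column \<open>w\<close> of \<open>K\<close> is zero.\<close>

lemma M_eq_0:
  assumes w: "u < n" "w < n" "u \<noteq> w" "d w = 0 \<or> d' w = 0" and M_sym: "M\<^sup>T = M"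
  shows "M $$ (u, w) = 0"
  using w(4)
proof
  assume "d w = 0"
  then have "L $$ (w, k) = 0" if "k < n" for k
    using that w by (auto simp: lap_def d_eq_0_iff)
  then have "M $$ (w, u) = 0"
    using w by (simp add: M_index)
  then show ?thesis using arg_cong[OF M_sym, of "\<lambda>X. X $$ (u, w)"] w M by simp
next
  assume d0: "d' w = 0"
  then have "b w k = 0" if "k < n" for k
    using that d'_eq_0_iff by blast
  then have "b k w = 0" if "k < n" for k
    using that w(2) sym[of k w] by (metis b_def)
  then have "K $$ (k, w) = 0" if "k < n" for k
    using that w d0 by (auto simp: lap_def)
  then show ?thesis
    using w by (simp add: M_index)
qed

lemma pos_def_imp_trivial:
  assumes n: "n \<ge> 2" and M_sym: "M\<^sup>T = M"
    and pos: "\<And>x. x \<in> carrier_vec n \<Longrightarrow> x \<noteq> 0\<^sub>v n \<Longrightarrow> x \<bullet> (M *\<^sub>v x) > 0"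
  shows "(\<forall>i<n. \<forall>j<n. a i j = 0) \<or> (\<forall>i<n. \<forall>j<n. b i j = 0)"
proof -
  have Msym: "M $$ (i, j) = M $$ (j, i)" if "i < n" "j < n" for i j
    using arg_cong[OF M_sym, of "\<lambda>X. X $$ (i, j)"] that M by simp
  have Mpos: "M $$ (i, i) > 0" if "i < n" for i
    using pos[of "unit_vec n i"] that M by (auto simp: mult_mat_unit_vec[OF M])
  have Mdiag1: "M $$ (i, i) = 1" if i: "i < n" and nz: "d i \<noteq> 0" "d' i \<noteq> 0" for i
  proof -
    have "d i \<ge> 1" "d' i \<ge> 1"
      using nz d_ge_1 d'_ge_1 by auto
    \<comment> \<open>Expanded, the product of the degrees is at least their sum minus 1, that is n
      - 2.\<close>
    then have "(d i - 1) * (d' i - 1) \<ge> 0" by simp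
    then have "M $$ (i, i) \<le> 1"
      using d_add_d'[OF i] M_diag[OF i] by (simp add: algebra_simps)
    moreover have "M $$ (i, i) \<ge> 1"
      using Mpos[OF i] Ints_nonzero_abs_ge1[OF M_Ints[OF i i]] by auto
    ultimately show ?thesis by simp
  qed
  have Moff: "M $$ (u, w) = 0" if "u < n" "w < n" "u \<noteq> w" "M $$ (u, u) = 1" "M $$ (w, w) = 1" for u w
  proof -
    \<comment> \<open>Evaluating the form at e_u + s e_w for s = 1 and s = -1 bounds the integer
      \<open>M $$ (u, w)\<close> strictly between -1 and 1.\<close>
    have quad: "M $$ (u, u) + 2 * s * M $$ (u, w) + s * s * M $$ (w, w) > 0" for s
    proof -
      let ?x = "unit_vec n u + s \<cdot>\<^sub>v unit_vec n w"
      have "?x $ u = 1" using that by simp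
      then have "?x \<noteq> 0\<^sub>v n" using that(1) by (metis index_zero_vec(1) zero_neq_one)
      then have "?x \<bullet> (M *\<^sub>v ?x) > 0" by (intro pos) auto
      moreover have "M *\<^sub>v ?x = col M u + s \<cdot>\<^sub>v col M w"
        using that M by (simp add: mult_add_distrib_mat_vec[of _ n n] mult_mat_vec[of _ n n] mult_mat_unit_vec[of _ n n])
      ultimately show ?thesis
        using that M Msym[of w u]
        by (simp add: add_scalar_prod_distrib[of _ n] algebra_simps)
    qed
    have "\<bar>M $$ (u, w)\<bar> < 1" using quad[of 1] quad[of "-1"] that by auto
    then show ?thesis using Ints_nonzero_abs_ge1[OF M_Ints[of u w]] that by fastforce
  qed
  have triv: "d i = 0 \<or> d' i = 0" if i: "i < n" for i
  proof (rule ccontr)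
    assume nz: "\<not> (d i = 0 \<or> d' i = 0)"
    then have Mi: "M $$ (i, i) = 1" using Mdiag1[OF i] by simp
    \<comment> \<open>Any other vertex either has one of its degrees zero, where
      \<open>M_eq_0\<close> applies, or also has diagonal entry 1, where \<open>Moff\<close>
      applies. The row sum then forces n = 2, but two degrees of at least 1 cannot add up to n - 1 =
      1.\<close>
    have "M $$ (i, j) = (if j = i then 1 else 0)" if "j < n" for j
    proof (cases "j = i")
      case False
      then show ?thesis
        using M_eq_0[OF i that _ _ M_sym] Moff[OF i that _ Mi] Mdiag1[OF that] by auto
    qed (use Mi in simp)
    then have "(\<Sum>j<n. M $$ (i, j)) = 1" using i by simp
    then have "real n = 2" using M_row_sum[OF i] by simp
    moreover have "d i \<ge> 1" "d' i \<ge> 1"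
      using nz d_ge_1 d'_ge_1 by auto
    ultimately show False using d_add_d'[OF i] by simp
  qed
  show ?thesis
  proof (cases "\<exists>i<n. d i \<noteq> 0")
    case True
    \<comment> \<open>A vertex with a neighbour is adjacent to all others. Each of these then has a
      neighbour itself, hence is adjacent to all others too.\<close>
    then obtain i where i: "i < n" "d' i = 0" using triv by blast
    have "d' j = 0" if j: "j < n" for j
    proof (cases "j = i")
      case False
      have "b i j = 0" using i j d'_eq_0_iff by blast
      then have "a j i = 1" using False sym[OF i(1) j] by (simp add: b_def)
      then have "d j \<noteq> 0" using i by (auto simp: d_eq_0_iff)
      then show ?thesis using triv[OF j] by simp
    qed (use i in simp)
    then show ?thesis by (simp add: d'_eq_0_iff)
  next
    case False
    then show ?thesis by (simp add: d_eq_0_iff)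
  qed
qed

section \<open>Counting the eigenvalues below 1\<close>

lemma count_lt_1:
  assumes n: "n \<ge> 1"
  defines "c A \<equiv> \<Sum>\<theta> | \<theta> \<in> {0..<1} \<and> eigenvalue A \<theta>. Polynomial.order \<theta> (char_poly A)"
  shows "c L + c K \<le> n + 1 \<and>
    (c L + c K = n + 1 \<longleftrightarrow> (\<forall>i<n. \<forall>j<n. a i j = 0) \<or> (\<forall>i<n. \<forall>j<n. b i j = 0))"
proof -
  obtain Q f where f: "orth_diag n L Q f" "f 0 = 0"
      and g': "orth_diag n K Q (\<lambda>i. if i = 0 then 0 else real n - f i)"
    using spectrum[OF n] by blast
  define g where "g i = (if i = 0 then 0 else real n - f i)" for i :: nat
  have g: "orth_diag n K Q g" using g' by (simp add: g_def[abs_def])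
  define S where "S = {i. i < n \<and> f i \<in> {0..<1}}"
  define T where "T = {i. i < n \<and> g i \<in> {0..<1}}"
  have cL: "c L = card S" and cK: "c K = card T"
    unfolding c_def S_def T_def
    by (rule sum_order_char_poly_orth_diag[OF L f(1)], rule sum_order_char_poly_orth_diag[OF K g])
  have fin: "finite S" "finite T" by (auto simp: S_def T_def)
  show ?thesis
  proof (cases "n = 1")
    case True
    \<comment> \<open>A single vertex gives equality outright; it is separated because the
      positivity argument needs n - 1 > 0.\<close>
    then have "S = {0}" "T = {0}" using f(2) by (auto simp: S_def T_def g_def)
    moreover have "\<forall>i<n. \<forall>j<n. a i j = 0" using True irrefl by auto
    ultimately show ?thesis using cL cK True by simp
  next
    case False
    then have n2: "n \<ge> 2" using n by simp
    \<comment> \<open>Index 0, the constant vector, is counted on both sides and accounts for the 1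
      in n + 1. Elsewhere \<open>f i < 1\<close> gives \<open>g i\<close> > n - 1 \<ge> 1.\<close>
    have "S \<inter> T = {0}"
      using n2 f(2) by (auto simp: S_def T_def g_def split: if_splits)
    then have card: "card S + card T = card (S \<union> T) + 1"
      using card_Un_Int[OF fin] by simp
    have sub: "S \<union> T \<subseteq> {..<n}" by (auto simp: S_def T_def)
    then have le: "card (S \<union> T) \<le> n" using card_mono[OF _ sub] by simp
    have eq: "card (S \<union> T) = n \<longleftrightarrow> S \<union> T = {..<n}"
    proof
      assume "card (S \<union> T) = n"
      then show "S \<union> T = {..<n}" by (intro card_subset_eq[OF _ sub]) simp_all
    qed simp
    \<comment> \<open>For the converse: a graph without edges has zero Laplacian, so all n indices
      are counted. This is applied to both \<open>L\<close> and \<open>K\<close>.\<close>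
    have zero: "h i = 0" if "orth_diag n (lap n w) Q h" "\<forall>i<n. \<forall>j<n. w i j = 0" "i < n" for h w i
    proof -
      have Q: "Q \<in> carrier_mat n n" "Q\<^sup>T * lap n w * Q = mat_diag n h"
        using that(1) by (auto simp: orth_diag_def)
      have "lap n w = 0\<^sub>m n n" using that(2) by (intro eq_matI) (auto simp: lap_def)
      then have "mat_diag n h = 0\<^sub>m n n" using Q by simp
      then have "mat_diag n h $$ (i, i) = 0" using that(3) by simp
      then show ?thesis using that(3) by (simp add: mat_diag_def)
    qed
    have "S \<union> T = {..<n} \<longleftrightarrow> (\<forall>i<n. \<forall>j<n. a i j = 0) \<or> (\<forall>i<n. \<forall>j<n. b i j = 0)"
    proof
      assume full: "S \<union> T = {..<n}"
      have od: "orth_diag n M Q (\<lambda>i. real n - 1 - f i * g i)"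
        unfolding M_def by (intro orth_diag_scalar_minus orth_diag_mult mult_carrier_mat[OF L K] L K f g)
      have "real n - 1 - f i * g i > 0" if "i < n" for i
      proof (cases "i = 0")
        case True
        then show ?thesis using n2 f(2) by simp
      next
        case False
        have "f i < 1 \<or> f i > real n - 1"
          using that full False by (force simp: S_def T_def g_def)
        \<comment> \<open>Both factors have the same sign, and the product expands to n - 1 - f i (n
          - f i), the eigenvalue of \<open>M\<close> at index \<open>i\<close>.\<close>
        then have "(1 - f i) * (real n - 1 - f i) > 0"
          using n2 by (auto intro: mult_pos_pos mult_neg_neg)
        then show ?thesis using False by (simp add: g_def algebra_simps)
      qed
      then show "(\<forall>i<n. \<forall>j<n. a i j = 0) \<or> (\<forall>i<n. \<forall>j<n. b i j = 0)"
        using pos_def_imp_trivial[OF n2 orth_diag_symmetric[OF M od]] orth_diag_pos[OF M od] by blast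
    next
      assume "(\<forall>i<n. \<forall>j<n. a i j = 0) \<or> (\<forall>i<n. \<forall>j<n. b i j = 0)"
      then have "S = {..<n} \<or> T = {..<n}"
        using zero[OF f(1)] zero[OF g] by (auto simp: S_def T_def)
      then show "S \<union> T = {..<n}" using sub by auto
    qed
    then show ?thesis using card le eq cL cK by simp
  qed
qed

end

section \<open>Graphs\<close>

lemma lap_cong:
  assumes "\<And>i j. i < n \<Longrightarrow> j < n \<Longrightarrow> a i j = a' i j"
  shows "lap n a = lap n a'"
  using assms by (intro eq_matI) (auto simp: lap_def)

text \<open>As \<open>vs\<close> lists every vertex exactly once, the arcs leaving
  \<open>vs ! i\<close> correspond to the positions of its neighbours, so the out-degree is a row
  sum.\<close>

lemma laplacian_mat_eq_lap:
  assumes "pair_graph G" and vs: "distinct vs" "set vs = pverts G"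
  shows "laplacian_mat vs G = lap (length vs) (\<lambda>i j. if (vs ! i, vs ! j) \<in> parcs G then 1 else 0)"
proof -
  interpret pair_graph G by fact
  have "real (out_degree (with_proj G) (vs ! i)) =
      (\<Sum>k<length vs. if (vs ! i, vs ! k) \<in> parcs G then 1 else 0)" if "i < length vs" for i
  proof -
    let ?N = "{k \<in> {..<length vs}. (vs ! i, vs ! k) \<in> parcs G}"
    have "out_arcs (with_proj G) (vs ! i) = (\<lambda>k. (vs ! i, vs ! k)) ` ?N"
    proof (intro equalityI subsetI)
      fix e assume "e \<in> out_arcs (with_proj G) (vs ! i)"
      then obtain w where e: "e = (vs ! i, w)" "(vs ! i, w) \<in> parcs G" by (cases e) auto
      then have "w \<in> set vs" using vs(2) in_arcsD2 by auto
      then obtain k where "k < length vs" "w = vs ! k" by (auto simp: in_set_conv_nth)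
      then show "e \<in> (\<lambda>k. (vs ! i, vs ! k)) ` ?N" using e by auto
    qed auto
    moreover have "inj_on (\<lambda>k. (vs ! i, vs ! k)) ?N"
      using vs(1) by (auto intro!: inj_onI simp: nth_eq_iff_index_eq)
    ultimately have "out_degree (with_proj G) (vs ! i) = card ?N"
      by (simp add: out_degree_def card_image)
    then show ?thesis by (simp add: sum.inter_filter[symmetric])
  qed
  then show ?thesis
    by (intro eq_matI) (auto simp: laplacian_mat_def degree_mat_def adjacency_mat_def lap_def)
qed

theorem theorem4:
  fixes G :: "'a pair_pre_digraph" and n :: nat
  assumes "pair_graph G"
    and "card (pverts G) = n"
    and "n \<ge> 1"
  shows "laplacian_count G {0..<1} + laplacian_count (graph_complement G) {0..<1} \<le> n + 1
    \<and> (laplacian_count G {0..<1} + laplacian_count (graph_complement G) {0..<1} = n + 1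
         \<longleftrightarrow> complete_digraph n (with_proj G) \<or> parcs G = {})"
proof -
  interpret pair_graph G by fact
  \<comment> \<open>One enumeration indexes both Laplacians, so they refer to the same basis;
    \<open>laplacian_count_enum\<close> allows it for the complement.\<close>
  define vs where "vs = vertex_enum G"
  have vs: "distinct vs" "set vs = pverts G"
    using vertex_enum[OF pair_finite_verts] by (simp_all add: vs_def)
  have len: "length vs = n" using vs assms(2) distinct_card by metis
  let ?C = "graph_complement G"
  have C: "pair_graph ?C" "pverts ?C = pverts G"
    using pair_graph_graph_complement[OF assms(1)] by (simp_all add: graph_complement_def)
  define a where "a i j = (if (vs ! i, vs ! j) \<in> parcs G then 1 else 0 :: real)" for i j
  have arc_sym: "(u, v) \<in> parcs G \<longleftrightarrow> (v, u) \<in> parcs G" for u v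
    using pair_sym_arcs by (auto simp: symmetric_def dest: symD)
  have no_loop: "(u, u) \<notin> parcs G" for u
    using pair_no_loops[of "(u, u)"] by auto
  have arc_verts: "u \<in> pverts G \<and> v \<in> pverts G" if "(u, v) \<in> parcs G" for u v
    using in_arcsD1[of u v] in_arcsD2[of u v] that by simp
  interpret adjacency n a
    by unfold_locales (auto simp: a_def arc_sym no_loop)
  have LG: "laplacian_mat vs G = lap n a"
    using laplacian_mat_eq_lap[OF assms(1) vs] len by (simp add: a_def[abs_def])
  have neq: "vs ! i \<noteq> vs ! j" if "i < n" "j < n" "i \<noteq> j" for i j
    using that vs(1) len by (simp add: nth_eq_iff_index_eq)
  have mem: "vs ! i \<in> pverts G" if "i < n" for i using that vs(2) len nth_mem by metis
  \<comment> \<open>The locale's \<open>b\<close> compares indices, the complement compares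
    vertices; below \<open>n\<close> these agree because \<open>vs\<close> is distinct.\<close>
  have b: "b i j = (if (vs ! i, vs ! j) \<in> parcs ?C then 1 else 0)" if "i < n" "j < n" for i j
    using that neq[of i j] mem by (auto simp: b_def a_def graph_complement_def)
  have LC: "laplacian_mat vs ?C = lap n b"
    using laplacian_mat_eq_lap[OF C(1) vs(1)] vs(2) len C(2) by (simp add: lap_cong[OF b])
  have all: "(\<forall>u\<in>pverts G. P u) \<longleftrightarrow> (\<forall>i<n. P (vs ! i))" for P
    using vs(2) len by (metis all_set_conv_all_nth)
  have "(\<forall>i<n. \<forall>j<n. a i j = 0) \<longleftrightarrow> (\<forall>u\<in>pverts G. \<forall>v\<in>pverts G. (u, v) \<notin> parcs G)"
    by (auto simp: all a_def)
  also have "\<dots> \<longleftrightarrow> parcs G = {}"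
    using arc_verts by auto
  finally have a0: "(\<forall>i<n. \<forall>j<n. a i j = 0) \<longleftrightarrow> parcs G = {}" .
  have "(\<forall>i<n. \<forall>j<n. b i j = 0) \<longleftrightarrow> (\<forall>u\<in>pverts G. \<forall>v\<in>pverts G. (u, v) \<notin> parcs ?C)"
    by (auto simp: all b)
  also have "\<dots> \<longleftrightarrow> complete_digraph n (with_proj G)"
    unfolding complete_digraph_pair_def using pair_finite_verts assms(2) no_loop arc_verts
    by (auto simp: graph_complement_def)
  finally have b0: "(\<forall>i<n. \<forall>j<n. b i j = 0) \<longleftrightarrow> complete_digraph n (with_proj G)" .
  have "finite (pverts ?C)" "set vs = pverts ?C" using C pair_finite_verts vs by simp_all
  then show ?thesis
    using count_lt_1[OF assms(3)] laplacian_count_enum[OF pair_finite_verts vs, of "{0..<1}"]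
      laplacian_count_enum[of ?C vs "{0..<1}"] vs(1)
    unfolding LG LC a0 b0 by auto
qed

end
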